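(* Let $(C,\tau^C)$ be a (non-empty) compact Hausdorff space and $(\Theta,\tau^\Theta)$ a (non-empty) Hausdorff space. Let $U:\Theta\times C\to\mathbb{R}$ be jointly continuous and $V:\Theta\times C\to\mathbb{R}$ jointly upper semicontinuous. Assume that either (i) $\Theta$ is compact, or (ii) $V$ is bounded. Let $\underline{u}:\Theta\to\mathbb{R}$ be a function for which there exists $c^*\in C$ with $U(\theta,c^* )\ge\underline{u}(\theta)$ for all $\theta\in\Theta$. Let $\mathbb{K}$ be a non-empty set of regular Borel probability measures on $\Theta$ and $\alpha:\mathbb{K}\to\mathbb{R}$ a function. Then the problem $$\sup_{\varphi\in\hat M}\ \inf_{\kappa\in\mathbb{K}}\left\{\int_\Theta V(\theta,\varphi(\theta))\,d\kappa(\theta)+\alpha(\kappa)\right\}$$ admits an optimal solution $\varphi^*\in\hat M$.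
   Context: A contract mechanism is an arbitrary map $\varphi:\Theta\to C$ (no measurability of $\varphi$ itself is required). It is individually rational if $U(\theta,\varphi(\theta))\ge\underline{u}(\theta)$ for all $\theta\in\Theta$, and incentive compatible if $U(\theta,\varphi(\theta))\ge U(\theta,\varphi(\theta'))$ for all $\theta,\theta'\in\Theta$. $M$ is the set of all individually rational and incentive compatible contract mechanisms, and $\hat M:=\{\varphi\in M:\ \theta\mapsto V(\theta,\varphi(\theta))\text{ is Borel measurable}\}$. The spaces need not be metrizable. A Borel probability measure is called regular if Borel sets are approximated in measure from inside by compact sets. Integrals of measurable functions bounded above and infima are taken with values in $[-\infty,\infty)$. *)

theory Defs
  imports "HOL-Probability.Probability"
begin

definition upper_semicontinuous :: "('a::topological_space \<Rightarrow> real) \<Rightarrow> bool" where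
  "upper_semicontinuous f \<longleftrightarrow> (\<forall>r. open {x. f x < r})"

definition individually_rational ::
  "('t \<times> 'c \<Rightarrow> real) \<Rightarrow> ('t \<Rightarrow> real) \<Rightarrow> ('t \<Rightarrow> 'c) \<Rightarrow> bool" where
  "individually_rational U u \<phi> \<longleftrightarrow> (\<forall>\<theta>. U (\<theta>, \<phi> \<theta>) \<ge> u \<theta>)"

definition incentive_compatible :: "('t \<times> 'c \<Rightarrow> real) \<Rightarrow> ('t \<Rightarrow> 'c) \<Rightarrow> bool" where
  "incentive_compatible U \<phi> \<longleftrightarrow> (\<forall>\<theta> \<theta>'. U (\<theta>, \<phi> \<theta>) \<ge> U (\<theta>, \<phi> \<theta>'))"

definition mechanisms :: "('t \<times> 'c \<Rightarrow> real) \<Rightarrow> ('t \<Rightarrow> real) \<Rightarrow> ('t \<Rightarrow> 'c) set" where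
  "mechanisms U u = {\<phi>. individually_rational U u \<phi> \<and> incentive_compatible U \<phi>}"

definition measurable_mechanisms ::
  "('t::topological_space \<times> 'c \<Rightarrow> real) \<Rightarrow> ('t \<times> 'c \<Rightarrow> real) \<Rightarrow> ('t \<Rightarrow> real) \<Rightarrow> ('t \<Rightarrow> 'c) set" where
  "measurable_mechanisms U V u =
     {\<phi> \<in> mechanisms U u. (\<lambda>\<theta>. V (\<theta>, \<phi> \<theta>)) \<in> borel_measurable borel}"

definition regular_borel_prob :: "'t::topological_space measure \<Rightarrow> bool" where
  "regular_borel_prob \<kappa> \<longleftrightarrow> prob_space \<kappa> \<and> sets \<kappa> = sets borel \<and>
     (\<forall>A\<in>sets borel. emeasure \<kappa> A = (SUP K\<in>{K. compact K \<and> K \<subseteq> A}. emeasure \<kappa> K))"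

(* The integral with values in [-\<infinity>, \<infinity>) of a measurable function that is bounded above,
   with respect to a finite measure: the positive part then has a finite integral, so the
   difference is never \<infinity> - \<infinity>. The library's Bochner integral is not suitable because it
   returns 0 when the negative part has an infinite integral. *)
definition ereal_integral :: "'t measure \<Rightarrow> ('t \<Rightarrow> real) \<Rightarrow> ereal" where
  "ereal_integral \<kappa> f =
     enn2ereal (\<integral>\<^sup>+ \<theta>. ennreal (f \<theta>) \<partial>\<kappa>) - enn2ereal (\<integral>\<^sup>+ \<theta>. ennreal (- f \<theta>) \<partial>\<kappa>)"

definition robust_value ::
  "('t \<times> 'c \<Rightarrow> real) \<Rightarrow> 't measure set \<Rightarrow> ('t measure \<Rightarrow> real) \<Rightarrow> ('t \<Rightarrow> 'c) \<Rightarrow> ereal" where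
  "robust_value V \<K> \<alpha> \<phi> = (INF \<kappa>\<in>\<K>. ereal_integral \<kappa> (\<lambda>\<theta>. V (\<theta>, \<phi> \<theta>)) + ereal (\<alpha> \<kappa>))"

end

theory Submission
  imports Defs
begin

text \<open>
  An incentive compatible mechanism \<open>\<phi>\<close> is governed by its indirect utility
  \<open>v \<theta> = U (\<theta>, \<phi> \<theta>)\<close>: given \<open>v\<close>, the contracts that type \<open>\<theta>\<close> may receive are those \<open>c\<close> with
  \<open>U (\<theta>, c) = v \<theta>\<close> and \<open>U (\<theta>', c) \<le> v \<theta>'\<close> for every type \<open>\<theta>'\<close>, and the principal does best by
  choosing among them one that maximizes \<open>V (\<theta>, _)\<close>. The admissible indirect utilities form a
  compact set in the product topology, by Tychonoff's theorem. They are equicontinuous, because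
  \<open>C\<close> is compact, and therefore the optimal selection has a value that is jointly upper
  semicontinuous in \<open>(\<theta>, v)\<close>. A simple function strictly below an integrand lives, up to a small
  error, on finitely many compact sets, by regularity of the measure; on each of them the tube lemma
  makes the strict inequality uniform in \<open>v\<close>. Hence the expected value is upper semicontinuous in
  \<open>v\<close>, and so is the infimum over the measures, which therefore attains its maximum.
\<close>

section \<open>Compactness\<close>

lemma open_if_eventually:
  assumes "\<And>x. x \<in> S \<Longrightarrow> \<forall>\<^sub>F y in nhds x. y \<in> S"
  shows "open S"
proof (rule topological_space_class.openI)
  fix x
  assume "x \<in> S"
  from assms[OF this] show "\<exists>T. open T \<and> x \<in> T \<and> T \<subseteq> S"
    unfolding eventually_nhds subset_eq .
qed

text \<open>The tube lemma in filter form: a property that holds near every point of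
  \<open>{x} \<times> K\<close> holds on a whole tube around it. It turns estimates near single
  points into estimates uniform over a compact set.\<close>

lemma eventually_tube:
  assumes "compact K"
    and "\<And>c. c \<in> K \<Longrightarrow> \<forall>\<^sub>F z in nhds (x, c). P (fst z) (snd z)"
  shows "\<forall>\<^sub>F y in nhds x. \<forall>c\<in>K. P y c"
proof -
  let ?W = "{w. \<forall>\<^sub>F z in nhds w. P (fst z) (snd z)}"
  have "open ?W"
    by (rule open_if_eventually) (simp add: eventually_eventually)
  moreover have "{x} \<times> K \<subseteq> ?W"
    using assms(2) by blast
  ultimately obtain X where X: "x \<in> X" "open X" "X \<times> K \<subseteq> ?W"
    using Elementary_Topology.tube_lemma[OF assms(1), of ?W x] by blast
  have "P y c" if "y \<in> X" "c \<in> K" for y c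
  proof -
    have "\<forall>\<^sub>F z in nhds (y, c). P (fst z) (snd z)"
      using X(3) that by blast
    from eventually_nhds_x_imp_x[OF this] show ?thesis
      by simp
  qed
  then show ?thesis
    unfolding eventually_nhds using X by blast
qed

text \<open>Without a maximum, relatively open sets on which \<open>F\<close> stays below some
  \<open>F y\<close> would cover \<open>S\<close>, and a finite subcover is impossible.
  Semicontinuity is asked for only relative to \<open>S\<close> and at values of \<open>F\<close>,
  so a linear order on the codomain suffices.\<close>

lemma compact_attains_max:
  fixes F :: "'a::topological_space \<Rightarrow> 'b::linorder"
  assumes "compact S" and "S \<noteq> {}"
    and usc: "\<And>x y. x \<in> S \<Longrightarrow> y \<in> S \<Longrightarrow> F x < F y \<Longrightarrow> \<forall>\<^sub>F z in nhds x. z \<in> S \<longrightarrow> F z < F y"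
  shows "\<exists>x\<in>S. \<forall>y\<in>S. F y \<le> F x"
proof (rule ccontr)
  assume neg: "\<not> ?thesis"
  have better: "\<exists>y\<in>S. F x < F y" if "x \<in> S" for x
    using neg that unfolding not_le[symmetric] by blast
  define \<X> where "\<X> = {X. open X \<and> (\<exists>y\<in>S. \<forall>z\<in>X \<inter> S. F z < F y)}"
  have "S \<subseteq> \<Union>\<X>"
  proof
    fix x
    assume "x \<in> S"
    then obtain y where "y \<in> S" "F x < F y"
      using better by blast
    from usc[OF \<open>x \<in> S\<close> this] obtain X where "open X" "x \<in> X" "\<forall>z\<in>X. z \<in> S \<longrightarrow> F z < F y"
      unfolding eventually_nhds by blast
    then show "x \<in> \<Union>\<X>"
      using \<open>y \<in> S\<close> unfolding \<X>_def by blast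
  qed
  moreover have "open X" if "X \<in> \<X>" for X
    using that unfolding \<X>_def by blast
  ultimately obtain \<D> where \<D>: "\<D> \<subseteq> \<X>" "finite \<D>" "S \<subseteq> \<Union>\<D>"
    by (rule compactE[OF \<open>compact S\<close>])
  have "\<forall>X\<in>\<D>. \<exists>y. y \<in> S \<and> (\<forall>z\<in>X \<inter> S. F z < F y)"
    using \<D>(1) unfolding \<X>_def by blast
  from bchoice[OF this] obtain y where y: "\<forall>X\<in>\<D>. y X \<in> S \<and> (\<forall>z\<in>X \<inter> S. F z < F (y X))"
    by blast
  let ?m = "Max ((\<lambda>X. F (y X)) ` \<D>)"
  have "\<D> \<noteq> {}"
    using \<D>(3) \<open>S \<noteq> {}\<close> by blast
  then have "?m \<in> (\<lambda>X. F (y X)) ` \<D>"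
    using \<D>(2) by (intro Max_in) simp_all
  then obtain X where X: "X \<in> \<D>" "?m = F (y X)"
    by blast
  \<comment> \<open>The point \<open>y X\<close> with the largest value is itself covered, and the
    bound belonging to its cover set exceeds that largest value.\<close>
  then obtain X' where X': "X' \<in> \<D>" "y X \<in> X'"
    using y \<D>(3) by blast
  then have "F (y X) < F (y X')"
    using X(1) y by blast
  also have "\<dots> \<le> ?m"
    using \<D>(2) X'(1) by (intro Max_ge) simp_all
  finally show False
    using X(2) by simp
qed

lemma upper_semicontinuous_eventually:
  assumes "upper_semicontinuous f" and "f x < a"
  shows "\<forall>\<^sub>F y in nhds x. f y < a"
  using assms unfolding upper_semicontinuous_def eventually_nhds by blast

lemma eventually_less_of_tendsto:
  fixes f g :: "'a \<Rightarrow> real"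
  assumes "(f \<longlongrightarrow> a) F" and "(g \<longlongrightarrow> b) F" and "a < b"
  shows "\<forall>\<^sub>F x in F. f x < g x"
proof -
  have "\<forall>\<^sub>F x in F. 0 < g x - f x"
    using assms by (intro order_tendstoD(1)[OF tendsto_diff]) auto
  then show ?thesis
    by eventually_elim simp
qed

section \<open>Integration\<close>

text \<open>A supremum of extended nonnegative reals is the limit of a sequence of members. With
  sequences, finitely many sets can be approximated simultaneously.\<close>

lemma regular_borel_prob_inner_tendsto:
  assumes "regular_borel_prob \<kappa>" and "A \<in> sets borel"
  shows "\<exists>K. (\<forall>n::nat. compact (K n) \<and> K n \<subseteq> A) \<and> (\<lambda>n. emeasure \<kappa> (K n)) \<longlonglongrightarrow> emeasure \<kappa> A"
proof -
  let ?\<C> = "{K. compact K \<and> K \<subseteq> A}"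
  have "{} \<in> ?\<C>"
    by simp
  then have "emeasure \<kappa> ` ?\<C> \<noteq> {}"
    by (metis empty_iff imageI)
  from ennreal_Sup_countable_SUP[OF this] obtain m :: "nat \<Rightarrow> ennreal"
    where m: "incseq m" "range m \<subseteq> emeasure \<kappa> ` ?\<C>" "(SUP K\<in>?\<C>. emeasure \<kappa> K) = (SUP n. m n)"
    by (elim exE conjE)
  have "\<forall>n. \<exists>K. (compact K \<and> K \<subseteq> A) \<and> emeasure \<kappa> K = m n"
  proof
    fix n
    have "m n \<in> emeasure \<kappa> ` ?\<C>"
      using m(2) by blast
    then show "\<exists>K. (compact K \<and> K \<subseteq> A) \<and> emeasure \<kappa> K = m n"
      by auto
  qed
  from choice[OF this] obtain K where K: "\<And>n. compact (K n) \<and> K n \<subseteq> A" "\<And>n. emeasure \<kappa> (K n) = m n"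
    by blast
  have "emeasure \<kappa> A = (SUP n. m n)"
    using assms m(3) unfolding regular_borel_prob_def by auto
  then show ?thesis
    using LIMSEQ_SUP[OF m(1)] K by (intro exI[of _ K]) simp
qed

text \<open>Take a simple function below \<open>f\<close> whose integral exceeds \<rho>, shrink its
  level sets to compact subsets and its values by a factor \<open>t < 1\<close>. Both losses can be
  made small, and the factor makes the comparison with \<open>f\<close> strict, as the tube lemma
  requires.\<close>

lemma regular_borel_prob_nn_integral_inner:
  fixes f :: "'t::t2_space \<Rightarrow> ennreal"
  assumes \<kappa>: "regular_borel_prob \<kappa>" and \<rho>: "\<rho> < (\<integral>\<^sup>+ \<theta>. f \<theta> \<partial>\<kappa>)"
  obtains Y K and t :: ennreal where "finite Y" "disjoint_family_on K Y"
    and "\<And>y. y \<in> Y \<Longrightarrow> compact (K y)"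
    and "\<And>y \<theta>. y \<in> Y \<Longrightarrow> \<theta> \<in> K y \<Longrightarrow> t * y < f \<theta>"
    and "\<rho> < (\<Sum>y\<in>Y. t * y * emeasure \<kappa> (K y))"
proof -
  interpret prob_space \<kappa>
    using \<kappa> unfolding regular_borel_prob_def by simp
  have sets_\<kappa>: "sets \<kappa> = sets borel"
    using \<kappa> unfolding regular_borel_prob_def by simp
  then have space_\<kappa>: "space \<kappa> = UNIV"
    by (simp add: sets_eq_imp_space_eq[where M' = borel])
  obtain g where g: "simple_function \<kappa> g" "g \<le> f" "\<And>x. g x < top" "\<rho> < integral\<^sup>S \<kappa> g"
    using \<rho> unfolding nn_integral_def_finite less_SUP_iff by auto
  define A where "A y = g -` {y}" for y
  \<comment> \<open>The value 0 adds nothing to the integral, and scaling it would not give a strict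
    inequality.\<close>
  define Y where "Y = range g - {0}"
  have "finite Y"
    using g(1) unfolding simple_function_def Y_def space_\<kappa> by simp
  have "A y \<in> sets borel" for y
    using simple_functionD(2)[OF g(1), of "{y}"] unfolding A_def space_\<kappa> sets_\<kappa> by simp
  then have "\<forall>y. \<exists>K. (\<forall>n::nat. compact (K n) \<and> K n \<subseteq> A y) \<and>
      (\<lambda>n. emeasure \<kappa> (K n)) \<longlonglongrightarrow> emeasure \<kappa> (A y)"
    by (intro allI regular_borel_prob_inner_tendsto[OF \<kappa>])
  from choice[OF this] obtain K where K: "\<And>y n::nat. compact (K y n) \<and> K y n \<subseteq> A y"
    "\<And>y. (\<lambda>n. emeasure \<kappa> (K y n)) \<longlonglongrightarrow> emeasure \<kappa> (A y)"
    by blast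
  have Y: "0 < y" "y < top" if "y \<in> Y" for y
    using that g(3) unfolding Y_def by (auto simp: zero_less_iff_neq_zero)
  \<comment> \<open>The values in \<open>Y\<close> are positive and finite, so multiplication by
    \<open>t n < 1\<close> decreases them strictly.\<close>
  define t :: "nat \<Rightarrow> ennreal" where "t n = ennreal (1 - 1 / Suc n)" for n
  have "t \<longlonglongrightarrow> ennreal 1"
    unfolding t_def by (intro tendsto_ennrealI) real_asymp
  then have t: "t \<longlonglongrightarrow> 1"
    by simp
  have "(\<lambda>n. t n * y * emeasure \<kappa> (K y n)) \<longlonglongrightarrow> 1 * y * emeasure \<kappa> (A y)" if "y \<in> Y" for y
    using Y[OF that] t K(2)
    by (intro tendsto_mult_ennreal tendsto_const) (auto simp: emeasure_eq_measure)
  then have "(\<lambda>n. \<Sum>y\<in>Y. t n * y * emeasure \<kappa> (K y n)) \<longlonglongrightarrow> (\<Sum>y\<in>Y. 1 * y * emeasure \<kappa> (A y))"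
    by (rule tendsto_sum)
  moreover have "(\<Sum>y\<in>Y. 1 * y * emeasure \<kappa> (A y)) = integral\<^sup>S \<kappa> g"
    unfolding simple_integral_def space_\<kappa> A_def Y_def
    using g(1) by (intro sum.mono_neutral_cong_left) (auto simp: simple_function_def space_\<kappa>)
  ultimately have "\<forall>\<^sub>F n in sequentially. \<rho> < (\<Sum>y\<in>Y. t n * y * emeasure \<kappa> (K y n))"
    using g(4) by (intro order_tendstoD(1)) simp_all
  then obtain n where n: "\<rho> < (\<Sum>y\<in>Y. t n * y * emeasure \<kappa> (K y n))"
    using eventually_happens'[OF sequentially_bot] by blast
  have "t n < 1"
    unfolding t_def by (simp add: ennreal_less_one_iff)
  have below: "t n * y < f \<theta>" if "y \<in> Y" "\<theta> \<in> K y n" for y \<theta>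
  proof -
    have "t n * y < 1 * y"
      using \<open>t n < 1\<close> Y[OF that(1)] ennreal_mult_strict_right_mono by blast
    also have "1 * y \<le> f \<theta>"
      using that K(1)[of y n] g(2) unfolding A_def by (auto simp: le_fun_def)
    finally show ?thesis .
  qed
  have "disjoint_family_on (\<lambda>y. K y n) Y"
    unfolding disjoint_family_on_def
  proof (intro ballI impI)
    fix y z :: ennreal
    assume "y \<noteq> z"
    then show "K y n \<inter> K z n = {}"
      using K(1)[of y n] K(1)[of z n] unfolding A_def by auto
  qed
  then show thesis
    by (rule that[OF \<open>finite Y\<close> _ _ below n]) (simp_all add: K(1))
qed

text \<open>A form of Fatou's lemma for neighbourhoods instead of sequences. Inner regularity
  replaces dominated or monotone convergence: on each of finitely many compact sets the lower bound
  persists uniformly for \<open>w\<close> near \<open>v\<close>.\<close>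

lemma nn_integral_lower_semicontinuous:
  fixes f :: "'v::topological_space \<Rightarrow> 't::t2_space \<Rightarrow> ennreal"
  assumes \<kappa>: "regular_borel_prob \<kappa>" and \<rho>: "\<rho> < (\<integral>\<^sup>+ \<theta>. f v \<theta> \<partial>\<kappa>)"
    and lsc: "\<And>\<theta> a. a < f v \<theta> \<Longrightarrow> \<forall>\<^sub>F z in nhds (v, \<theta>). fst z \<in> S \<longrightarrow> a < f (fst z) (snd z)"
  shows "\<forall>\<^sub>F w in nhds v. w \<in> S \<longrightarrow> \<rho> < (\<integral>\<^sup>+ \<theta>. f w \<theta> \<partial>\<kappa>)"
proof -
  obtain Y K and t :: ennreal where YK: "finite Y" "disjoint_family_on K Y"
    "\<And>y. y \<in> Y \<Longrightarrow> compact (K y)"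
    "\<And>y \<theta>. y \<in> Y \<Longrightarrow> \<theta> \<in> K y \<Longrightarrow> t * y < f v \<theta>"
    "\<rho> < (\<Sum>y\<in>Y. t * y * emeasure \<kappa> (K y))"
    by (rule regular_borel_prob_nn_integral_inner[OF \<kappa> \<rho>]) blast
  have "sets \<kappa> = sets borel"
    using \<kappa> unfolding regular_borel_prob_def by simp
  then have sets_K: "K y \<in> sets \<kappa>" if "y \<in> Y" for y
    using YK(3)[OF that] by (simp add: borel_closed compact_imp_closed)
  have "\<forall>\<^sub>F w in nhds v. \<forall>\<theta>\<in>K y. w \<in> S \<longrightarrow> t * y < f w \<theta>" if "y \<in> Y" for y
    using YK(3,4)[OF that] lsc
    by (intro eventually_tube) auto
  then have "\<forall>\<^sub>F w in nhds v. \<forall>y\<in>Y. \<forall>\<theta>\<in>K y. w \<in> S \<longrightarrow> t * y < f w \<theta>"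
    using YK(1) by (intro eventually_ball_finite) auto
  then show ?thesis
  proof (eventually_elim, intro impI)
    case (elim w)
    assume "w \<in> S"
    \<comment> \<open>By disjointness at most one summand is nonzero at a given point.\<close>
    have "(\<Sum>y\<in>Y. t * y * indicator (K y) \<theta>) \<le> f w \<theta>" for \<theta>
    proof (cases "\<exists>y\<in>Y. \<theta> \<in> K y")
      case True
      then obtain y where y: "y \<in> Y" "\<theta> \<in> K y"
        by blast
      have "(\<Sum>y'\<in>Y. t * y' * indicator (K y') \<theta>) = (\<Sum>y'\<in>{y}. t * y' * indicator (K y') \<theta>)"
        using YK(1,2) y by (intro sum.mono_neutral_right)
          (auto simp: disjoint_family_on_def indicator_def)
      also have "\<dots> \<le> f w \<theta>"
        using elim y \<open>w \<in> S\<close> by (simp add: less_imp_le)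
      finally show ?thesis .
    qed (simp add: sum.neutral)
    then have "(\<integral>\<^sup>+ \<theta>. (\<Sum>y\<in>Y. t * y * indicator (K y) \<theta>) \<partial>\<kappa>) \<le> (\<integral>\<^sup>+ \<theta>. f w \<theta> \<partial>\<kappa>)"
      by (intro nn_integral_mono)
    moreover have "(\<integral>\<^sup>+ \<theta>. (\<Sum>y\<in>Y. t * y * indicator (K y) \<theta>) \<partial>\<kappa>) = (\<Sum>y\<in>Y. t * y * emeasure \<kappa> (K y))"
      using sets_K by (simp add: nn_integral_sum nn_integral_cmult_indicator)
    ultimately show "\<rho> < (\<integral>\<^sup>+ \<theta>. f w \<theta> \<partial>\<kappa>)"
      using YK(5) by simp
  qed
qed

text \<open>Integrate the identity \<open>(B - f)\<^sup>+ + f\<^sup>+ = B + f\<^sup>-\<close>. The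
  formula leaves a single nonnegative integral, so that upper semicontinuity of the value becomes
  lower semicontinuity of that integral.\<close>

lemma ereal_integral_bounded_above:
  assumes "prob_space \<kappa>" and f: "f \<in> borel_measurable \<kappa>" and B: "0 \<le> B" "\<And>\<theta>. f \<theta> \<le> B"
  shows "ereal_integral \<kappa> f = ereal B - enn2ereal (\<integral>\<^sup>+ \<theta>. ennreal (B - f \<theta>) \<partial>\<kappa>)"
proof -
  interpret prob_space \<kappa>
    by fact
  let ?p = "\<integral>\<^sup>+ \<theta>. ennreal (f \<theta>) \<partial>\<kappa>" and ?n = "\<integral>\<^sup>+ \<theta>. ennreal (- f \<theta>) \<partial>\<kappa>"
    and ?q = "\<integral>\<^sup>+ \<theta>. ennreal (B - f \<theta>) \<partial>\<kappa>"
  have "?q + ?p = (\<integral>\<^sup>+ \<theta>. ennreal (B - f \<theta>) + ennreal (f \<theta>) \<partial>\<kappa>)"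
    using f by (simp add: nn_integral_add)
  also have "\<dots> = (\<integral>\<^sup>+ \<theta>. ennreal B + ennreal (- f \<theta>) \<partial>\<kappa>)"
  proof (intro nn_integral_cong)
    fix \<theta>
    show "ennreal (B - f \<theta>) + ennreal (f \<theta>) = ennreal B + ennreal (- f \<theta>)"
      using B(1) B(2)[of \<theta>] by (cases "0 \<le> f \<theta>") (auto simp: ennreal_neg simp flip: ennreal_plus)
  qed
  also have "\<dots> = ennreal B + ?n"
    using f by (simp add: nn_integral_add emeasure_space_1)
  finally have eq: "?q + ?p = ennreal B + ?n" .
  \<comment> \<open>The positive part has a finite integral and can be cancelled, also when the
    negative part has an infinite one.\<close>
  have "?p \<le> (\<integral>\<^sup>+ \<theta>. ennreal B \<partial>\<kappa>)"
    using B by (intro nn_integral_mono ennreal_leI) auto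
  then have "?p \<le> ennreal B"
    by (simp add: emeasure_space_1)
  then obtain p where p: "?p = ennreal p" "0 \<le> p"
    by (metis ennreal_cases ennreal_neq_top neq_top_trans)
  show ?thesis
  proof (cases ?n)
    case top
    then have "?q = top"
      using eq p by (simp add: ennreal_add_eq_top)
    then show ?thesis
      using top p unfolding ereal_integral_def by (simp add: enn2ereal_ennreal)
  next
    case (real n)
    then have "?q \<noteq> top"
      using eq p B(1) by (metis ennreal_add_eq_top ennreal_neq_top)
    then obtain q where q: "?q = ennreal q" "0 \<le> q"
      by (metis ennreal_cases)
    have "q + p = B + n"
      using eq p q real B(1) by (simp flip: ennreal_plus)
    then show ?thesis
      using p q real unfolding ereal_integral_def by (simp add: enn2ereal_ennreal)
  qed
qed

section \<open>Indirect utilities\<close>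

locale screening =
  fixes U V :: "'t::t2_space \<times> 'c::t2_space \<Rightarrow> real"
  assumes compact_contracts: "compact (UNIV :: 'c set)"
    and continuous_U: "continuous_on UNIV U"
    and usc_V: "upper_semicontinuous V"
begin

text \<open>The conditions force \<open>U (\<theta>, c) = v \<theta>\<close>.\<close>

definition menu :: "('t \<Rightarrow> real) \<Rightarrow> 't \<Rightarrow> 'c set" where
  "menu v \<theta> = {c. v \<theta> \<le> U (\<theta>, c) \<and> (\<forall>\<theta>'. U (\<theta>', c) \<le> v \<theta>')}"

text \<open>These are the functions \<open>\<lambda>\<theta>. U (\<theta>, \<phi> \<theta>)\<close>
  of incentive compatible \<phi>: any choice of contracts from the menus is incentive compatible. In
  abstract convexity, \<open>menu v\<close> is the subdifferential of \<open>v\<close> with respect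
  to \<open>U\<close>.\<close>

definition indirect_utilities :: "('t \<Rightarrow> real) set" where
  "indirect_utilities = {v. \<forall>\<theta>. menu v \<theta> \<noteq> {}}"

text \<open>Ties are broken arbitrarily; only the value of \<open>V\<close> at the selection has to
  be measurable.\<close>

definition selection :: "('t \<Rightarrow> real) \<Rightarrow> 't \<Rightarrow> 'c" where
  "selection v \<theta> = (SOME c. c \<in> menu v \<theta> \<and> (\<forall>c'\<in>menu v \<theta>. V (\<theta>, c') \<le> V (\<theta>, c)))"

lemma tendsto_U: "(U \<longlongrightarrow> U z) (nhds z)"
  using continuous_U unfolding continuous_on_eq_continuous_at[OF open_UNIV] isCont_def tendsto_nhds_iff
  by blast

lemma tendsto_eval: "((\<lambda>v::'t \<Rightarrow> real. v \<theta>) \<longlongrightarrow> v \<theta>) (nhds v)"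
proof (rule topological_tendstoI)
  fix A :: "real set"
  assume "open A" "v \<theta> \<in> A"
  moreover have "continuous_on UNIV (\<lambda>v::'t \<Rightarrow> real. v \<theta>)"
    by (rule continuous_on_product_coordinates)
  ultimately show "\<forall>\<^sub>F w in nhds v. w \<theta> \<in> A"
    unfolding eventually_nhds
    by (intro exI[of _ "(\<lambda>v. v \<theta>) -` A"]) (auto intro: open_vimage)
qed

lemma continuous_U_slice: "continuous_on UNIV (\<lambda>c. U (\<theta>, c))"
  by (intro continuous_on_compose2[OF continuous_U]) (auto intro!: continuous_intros)

lemma compact_menu: "compact (menu v \<theta>)"
proof -
  have "menu v \<theta> = {c. v \<theta> \<le> U (\<theta>, c)} \<inter> (\<Inter>\<theta>'. {c. U (\<theta>', c) \<le> v \<theta>'})"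
    unfolding menu_def by auto
  moreover have "closed \<dots>"
    by (intro closed_Int closed_INT ballI closed_Collect_le continuous_U_slice continuous_on_const)
  ultimately show ?thesis
    using compact_Int_closed[OF compact_contracts] by simp
qed

lemma selection:
  assumes "v \<in> indirect_utilities"
  shows "selection v \<theta> \<in> menu v \<theta>" and "c \<in> menu v \<theta> \<Longrightarrow> V (\<theta>, c) \<le> V (\<theta>, selection v \<theta>)"
proof -
  have "\<exists>c\<in>menu v \<theta>. \<forall>c'\<in>menu v \<theta>. V (\<theta>, c') \<le> V (\<theta>, c)"
  proof (rule compact_attains_max[OF compact_menu])
    show "menu v \<theta> \<noteq> {}"
      using assms unfolding indirect_utilities_def by blast
    fix c d
    assume "V (\<theta>, c) < V (\<theta>, d)"
    then have "\<forall>\<^sub>F z in nhds (\<theta>, c). V z < V (\<theta>, d)"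
      by (rule upper_semicontinuous_eventually[OF usc_V])
    moreover have "((\<lambda>c'. (\<theta>, c')) \<longlongrightarrow> (\<theta>, c)) (nhds c)"
      by (intro tendsto_intros filterlim_ident)
    ultimately have "\<forall>\<^sub>F c' in nhds c. V (\<theta>, c') < V (\<theta>, d)"
      by (rule eventually_compose_filterlim)
    then show "\<forall>\<^sub>F c' in nhds c. c' \<in> menu v \<theta> \<longrightarrow> V (\<theta>, c') < V (\<theta>, d)"
      by eventually_elim simp
  qed
  then have "selection v \<theta> \<in> menu v \<theta> \<and> (\<forall>c'\<in>menu v \<theta>. V (\<theta>, c') \<le> V (\<theta>, selection v \<theta>))"
    unfolding selection_def Bex_def by (rule someI_ex)
  then show "selection v \<theta> \<in> menu v \<theta>" "c \<in> menu v \<theta> \<Longrightarrow> V (\<theta>, c) \<le> V (\<theta>, selection v \<theta>)"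
    by auto
qed

text \<open>If a menu is empty, every contract violates one of its conditions strictly. The
  violation persists nearby, uniformly in the contract because the contract space is compact, so the
  menu of that type stays empty.\<close>

lemma closed_indirect_utilities: "closed indirect_utilities"
proof -
  have "\<forall>\<^sub>F w in nhds v. w \<in> - indirect_utilities" if v: "v \<in> - indirect_utilities" for v
  proof -
    obtain \<theta> where \<theta>: "menu v \<theta> = {}"
      using v unfolding indirect_utilities_def by blast
    have "\<forall>\<^sub>F w in nhds v. \<forall>c\<in>UNIV. c \<notin> menu w \<theta>"
    proof (rule eventually_tube[OF compact_contracts])
      fix c
      have lim: "((\<lambda>z. U (\<theta>', snd z)) \<longlongrightarrow> U (\<theta>', c)) (nhds (v, c))"
        "((\<lambda>z. fst z \<theta>') \<longlongrightarrow> v \<theta>') (nhds (v, c))" for \<theta>'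
        unfolding nhds_prod
        by (rule filterlim_compose[OF tendsto_U] filterlim_compose[OF tendsto_eval];
            intro tendsto_intros filterlim_fst filterlim_snd)+
      from \<theta> have "c \<notin> menu v \<theta>"
        by simp
      then consider "U (\<theta>, c) < v \<theta>" | \<theta>' where "v \<theta>' < U (\<theta>', c)"
        unfolding menu_def by (auto simp: not_le)
      then show "\<forall>\<^sub>F z in nhds (v, c). snd z \<notin> menu (fst z) \<theta>"
      proof cases
        case 1
        have "\<forall>\<^sub>F z in nhds (v, c). U (\<theta>, snd z) < fst z \<theta>"
          by (rule eventually_less_of_tendsto[OF lim 1])
        then show ?thesis
          by eventually_elim (auto simp: menu_def)
      next
        case 2
        have "\<forall>\<^sub>F z in nhds (v, c). fst z \<theta>' < U (\<theta>', snd z)"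
          by (rule eventually_less_of_tendsto[OF lim(2) lim(1) 2])
        then show ?thesis
          by eventually_elim (force simp: menu_def not_le[symmetric])
      qed
    qed
    then show ?thesis
      by eventually_elim (auto simp: indirect_utilities_def)
  qed
  then show ?thesis
    unfolding closed_def by (rule open_if_eventually)
qed

text \<open>Each \<open>v \<theta>\<close> is a value of \<open>U (\<theta>, _)\<close>, so the set
  is a closed part of a product of compact ranges, which Tychonoff's theorem makes compact.\<close>

lemma compact_indirect_utilities: "compact {v \<in> indirect_utilities. \<forall>\<theta>. u \<theta> \<le> v \<theta>}"
proof -
  let ?S = "{v \<in> indirect_utilities. \<forall>\<theta>. u \<theta> \<le> v \<theta>}"
  let ?P = "PiE UNIV (\<lambda>\<theta>. range (\<lambda>c. U (\<theta>, c)))"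
  have "compactin (product_topology (\<lambda>_. euclidean) UNIV) ?P"
    unfolding compactin_PiE
    using compact_continuous_image[OF continuous_U_slice compact_contracts] by simp
  then have "compact ?P"
    by (simp add: euclidean_product_topology)
  moreover have "closed ?S"
  proof -
    have "?S = indirect_utilities \<inter> (\<Inter>\<theta>. {v. u \<theta> \<le> v \<theta>})"
      by auto
    then show ?thesis
      by (auto intro!: closed_Int closed_indirect_utilities closed_INT closed_Collect_le
          continuous_on_product_coordinates)
  qed
  moreover have "?S \<subseteq> ?P"
  proof
    fix v
    assume "v \<in> ?S"
    then have "\<exists>c. c \<in> menu v \<theta>" for \<theta>
      unfolding indirect_utilities_def by blast
    then have "v \<theta> \<in> range (\<lambda>c. U (\<theta>, c))" for \<theta>
      unfolding menu_def by (metis (mono_tags, lifting) mem_Collect_eq order_antisym rangeI)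
    then show "v \<in> ?P"
      by (simp add: PiE_UNIV_domain)
  qed
  ultimately show ?thesis
    using compact_Int_closed[of ?P ?S] by (simp add: Int_absorb1)
qed

text \<open>That a contract outside the menu stays outside nearby needs the
  evaluation \<open>(v, \<theta>) \<mapsto> v \<theta>\<close> to be continuous, which is where equicontinuity enters.\<close>

lemma eventually_value_less:
  assumes v: "v \<in> indirect_utilities" and a: "V (\<theta>, selection v \<theta>) < a"
  shows "\<forall>\<^sub>F z in nhds (v, \<theta>).
    fst z \<in> indirect_utilities \<longrightarrow> V (snd z, selection (fst z) (snd z)) < a"
proof -
  \<comment> \<open>The selection need not be continuous, so the bound is proved for all contracts
    of nearby menus at once.\<close>
  have "\<forall>\<^sub>F z in nhds (v, \<theta>). \<forall>c\<in>UNIV.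
    fst z \<in> indirect_utilities \<longrightarrow> c \<in> menu (fst z) (snd z) \<longrightarrow> V (snd z, c) < a"
  proof (rule eventually_tube[OF compact_contracts])
    fix c :: 'c
    have lim: "((\<lambda>z. z) \<longlongrightarrow> ((v, \<theta>), c)) (nhds ((v, \<theta>), c))"
      by (rule filterlim_ident)
    have lim_v: "((\<lambda>z. fst (fst z) \<theta>') \<longlongrightarrow> v \<theta>') (nhds ((v, \<theta>), c))" for \<theta>'
      using tendsto_fst[OF tendsto_fst[OF lim]] by (intro filterlim_compose[OF tendsto_eval]) simp
    have lim_\<theta>: "((\<lambda>z. snd (fst z)) \<longlongrightarrow> \<theta>) (nhds ((v, \<theta>), c))"
      using tendsto_snd[OF tendsto_fst[OF lim]] by simp
    have lim_c: "(snd \<longlongrightarrow> c) (nhds ((v, \<theta>), c))"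
      using tendsto_snd[OF lim] by simp
    have lim_U: "((\<lambda>z. U (\<theta>', snd z)) \<longlongrightarrow> U (\<theta>', c)) (nhds ((v, \<theta>), c))" for \<theta>'
      by (rule filterlim_compose[OF tendsto_U]) (intro tendsto_intros lim_c)
    \<comment> \<open>Contracts in the menu are handled by semicontinuity of \<open>V\<close>; all
      others are shown to be outside nearby menus. In the last case \<theta>' is fixed and pointwise
      closeness suffices; in the second the type moves too.\<close>
    consider "c \<in> menu v \<theta>" | "U (\<theta>, c) < v \<theta>" | \<theta>' where "v \<theta>' < U (\<theta>', c)"
      unfolding menu_def mem_Collect_eq using not_le by blast
    then show "\<forall>\<^sub>F z in nhds ((v, \<theta>), c). fst (fst z) \<in> indirect_utilities \<longrightarrow>
      snd z \<in> menu (fst (fst z)) (snd (fst z)) \<longrightarrow> V (snd (fst z), snd z) < a"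
    proof cases
      case 1
      then have "V (\<theta>, c) < a"
        using selection(2)[OF v] a by (meson le_less_trans)
      then have "\<forall>\<^sub>F w in nhds (\<theta>, c). V w < a"
        by (rule upper_semicontinuous_eventually[OF usc_V])
      moreover have "((\<lambda>z. (snd (fst z), snd z)) \<longlongrightarrow> (\<theta>, c)) (nhds ((v, \<theta>), c))"
        by (intro tendsto_intros lim_\<theta> lim_c)
      ultimately have "\<forall>\<^sub>F z in nhds ((v, \<theta>), c). V (snd (fst z), snd z) < a"
        by (rule eventually_compose_filterlim)
      then show ?thesis
        by eventually_elim simp
    next
      case 2
      \<comment> \<open>A quarter of the gap, since four errors below \<epsilon> add up: from
        \<open>v\<close> to \<open>w\<close> at \<theta>, two changes of type in \<open>U\<close>,
        and from \<open>d\<close> to \<open>c\<close>.\<close>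
      define \<epsilon> where "\<epsilon> = (v \<theta> - U (\<theta>, c)) / 4"
      have \<epsilon>: "0 < \<epsilon>" "v \<theta> = U (\<theta>, c) + 4 * \<epsilon>"
        using 2 unfolding \<epsilon>_def by (simp_all add: field_simps)
      \<comment> \<open>Equicontinuity at \<theta> of the functions \<open>U (_, d)\<close>.\<close>
      have "\<forall>\<^sub>F \<eta> in nhds \<theta>. \<forall>d\<in>UNIV. dist (U (\<eta>, d)) (U (\<theta>, d)) < \<epsilon>"
      proof (rule eventually_tube[OF compact_contracts])
        fix d
        have "((\<lambda>z. dist (U (fst z, snd z)) (U (\<theta>, snd z))) \<longlongrightarrow> dist (U (\<theta>, d)) (U (\<theta>, d)))
          (nhds (\<theta>, d))"
          unfolding nhds_prod
          by (rule tendsto_dist; rule filterlim_compose[OF tendsto_U];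
              intro tendsto_intros filterlim_fst filterlim_snd)
        then show "\<forall>\<^sub>F z in nhds (\<theta>, d). dist (U (fst z, snd z)) (U (\<theta>, snd z)) < \<epsilon>"
          using \<epsilon>(1) by (intro order_tendstoD(2)) auto
      qed
      from eventually_compose_filterlim[OF this lim_\<theta>]
      have "\<forall>\<^sub>F z in nhds ((v, \<theta>), c). \<forall>d. dist (U (snd (fst z), d)) (U (\<theta>, d)) < \<epsilon>"
        by simp
      moreover have "\<forall>\<^sub>F z in nhds ((v, \<theta>), c). v \<theta> - \<epsilon> < fst (fst z) \<theta>"
        using \<epsilon>(1) by (intro order_tendstoD(1)[OF lim_v]) simp
      moreover have "\<forall>\<^sub>F z in nhds ((v, \<theta>), c). U (\<theta>, snd z) < U (\<theta>, c) + \<epsilon>"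
        using \<epsilon>(1) by (intro order_tendstoD(2)[OF lim_U]) simp
      ultimately show ?thesis
      proof (eventually_elim, intro impI)
        case (elim z)
        define w \<eta> d where "w = fst (fst z)" and "\<eta> = snd (fst z)" and "d = snd z"
        note near = elim(1-3)[folded w_def \<eta>_def d_def]
        assume "fst (fst z) \<in> indirect_utilities" "snd z \<in> menu (fst (fst z)) (snd (fst z))"
        then have w: "w \<in> indirect_utilities" and d: "d \<in> menu w \<eta>"
          unfolding w_def \<eta>_def d_def .
        \<comment> \<open>The contract \<open>e\<close> links the values of \<open>w\<close> at the
          two types: \<open>w \<theta> \<le> U (\<theta>, e)\<close>, which is close to
          \<open>U (\<eta>, e) \<le> w \<eta>\<close>.\<close>
        obtain e where e: "e \<in> menu w \<theta>"
          using w unfolding indirect_utilities_def by blast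
        have "w \<theta> \<le> U (\<theta>, e)" "U (\<eta>, e) \<le> w \<eta>" "w \<eta> \<le> U (\<eta>, d)"
          using d e unfolding menu_def by auto
        moreover have "\<bar>U (\<eta>, e) - U (\<theta>, e)\<bar> < \<epsilon>" "\<bar>U (\<eta>, d) - U (\<theta>, d)\<bar> < \<epsilon>"
          using near(1) unfolding dist_real_def by auto
        ultimately have False
          using near(2,3) \<epsilon>(2) by linarith
        then show "V (snd (fst z), snd z) < a" ..
      qed
    next
      case 3
      have "\<forall>\<^sub>F z in nhds ((v, \<theta>), c). fst (fst z) \<theta>' < U (\<theta>', snd z)"
        by (rule eventually_less_of_tendsto[OF lim_v lim_U 3])
      then show ?thesis
        by eventually_elim (force simp: menu_def not_le[symmetric])
    qed
  qed
  then show ?thesis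
    by eventually_elim (use selection(1) in blast)
qed

text \<open>For fixed \<open>v\<close> the optimal value is upper semicontinuous in the type, so its
  strict sublevel sets are open and hence Borel.\<close>

lemma selection_in_measurable_mechanisms:
  assumes v: "v \<in> indirect_utilities" and u: "\<forall>\<theta>. u \<theta> \<le> v \<theta>"
  shows "selection v \<in> measurable_mechanisms U V u"
proof -
  have sel: "v \<theta> \<le> U (\<theta>, selection v \<theta>)" "U (\<theta>', selection v \<theta>) \<le> v \<theta>'" for \<theta> \<theta>'
    using selection(1)[OF v, of \<theta>] unfolding menu_def by auto
  have "open {\<theta>. V (\<theta>, selection v \<theta>) < a}" for a
  proof -
    have "\<forall>\<^sub>F \<eta> in nhds \<theta>. V (\<eta>, selection v \<eta>) < a" if "V (\<theta>, selection v \<theta>) < a" for \<theta>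
    proof -
      have "((\<lambda>\<eta>. (v, \<eta>)) \<longlongrightarrow> (v, \<theta>)) (nhds \<theta>)"
        by (intro tendsto_intros filterlim_ident)
      then show ?thesis
        using eventually_compose_filterlim[OF eventually_value_less[OF v that]] v by fastforce
    qed
    then show ?thesis
      by (intro open_if_eventually) simp
  qed
  then have "(\<lambda>\<theta>. V (\<theta>, selection v \<theta>)) \<in> borel_measurable borel"
    by (intro borel_measurableI_less) auto
  moreover have "individually_rational U u (selection v)"
    unfolding individually_rational_def using sel(1) u order_trans by blast
  moreover have "incentive_compatible U (selection v)"
    unfolding incentive_compatible_def using order_trans[OF sel(2) sel(1)] by blast
  ultimately show ?thesis
    unfolding measurable_mechanisms_def mechanisms_def by simp
qed

text \<open>Every mechanism is a competitor of the optimal selection for its own indirect utility,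
  which reduces the problem to selections.\<close>

lemma mechanism_in_menu:
  assumes "\<phi> \<in> mechanisms U u"
  defines "v \<equiv> \<lambda>\<theta>. U (\<theta>, \<phi> \<theta>)"
  shows "v \<in> indirect_utilities" and "\<forall>\<theta>. u \<theta> \<le> v \<theta>" and "\<phi> \<theta> \<in> menu v \<theta>"
proof -
  have ic: "U (\<theta>, \<phi> \<theta>') \<le> v \<theta>" and ir: "u \<theta> \<le> v \<theta>" for \<theta> \<theta>'
    using assms(1)
    unfolding v_def mechanisms_def individually_rational_def incentive_compatible_def by simp_all
  have menu: "\<phi> \<theta> \<in> menu v \<theta>" for \<theta>
    unfolding menu_def using ic by (simp add: v_def)
  then show "v \<in> indirect_utilities"
    unfolding indirect_utilities_def by blast
  show "\<forall>\<theta>. u \<theta> \<le> v \<theta>"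
    using ir by blast
  show "\<phi> \<theta> \<in> menu v \<theta>"
    by (rule menu)
qed

end

section \<open>Existence of an optimal mechanism\<close>

lemma ereal_diff_add_less_iff:
  "ereal b - enn2ereal q + ereal a < ereal r \<longleftrightarrow> b + a - r < 0 \<or> ennreal (b + a - r) < q"
proof (cases q)
  case (real x)
  then show ?thesis
    by (cases "b + a - r < 0") (auto simp: enn2ereal_ennreal ennreal_less_iff)
next
  case top
  then show ?thesis
    by simp
qed

theorem theorem4:
  fixes U V :: "'t::t2_space \<times> 'c::t2_space \<Rightarrow> real"
    and u :: "'t \<Rightarrow> real"
    and \<K> :: "'t measure set"
    and \<alpha> :: "'t measure \<Rightarrow> real"
  assumes "compact (UNIV :: 'c set)"
    and "continuous_on UNIV U"
    and "upper_semicontinuous V"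
    and "compact (UNIV :: 't set) \<or> bounded (range V)"
    and "\<exists>c. \<forall>\<theta>. U (\<theta>, c) \<ge> u \<theta>"
    and "\<K> \<noteq> {}"
    and "\<forall>\<kappa>\<in>\<K>. regular_borel_prob \<kappa>"
  shows "\<exists>\<phi> \<in> measurable_mechanisms U V u.
           robust_value V \<K> \<alpha> \<phi> = (SUP \<psi>\<in>measurable_mechanisms U V u. robust_value V \<K> \<alpha> \<psi>)"
proof -
  interpret screening U V
    using assms(1-3) by unfold_locales
  \<comment> \<open>In the compact case, an upper semicontinuous function attains its maximum on the
    product of the two spaces.\<close>
  have "\<exists>B. \<forall>z. V z \<le> B"
    using assms(4)
  proof
    assume "compact (UNIV :: 't set)"
    then have "compact (UNIV :: ('t \<times> 'c) set)"
      using compact_Times[OF _ assms(1)] by (simp flip: UNIV_Times_UNIV)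
    then have "\<exists>z\<in>UNIV. \<forall>w\<in>UNIV. V w \<le> V z"
      by (rule compact_attains_max) (auto intro: upper_semicontinuous_eventually[OF assms(3)])
    then show ?thesis
      by blast
  next
    assume "bounded (range V)"
    then show ?thesis
      unfolding bounded_real by (auto intro: order_trans[OF abs_ge_self])
  qed
  then obtain B0 where B0: "\<And>z. V z \<le> B0"
    by blast
  define B where "B = max 0 B0"
  have B: "0 \<le> B" "\<And>z. V z \<le> B"
    using B0 unfolding B_def by (auto simp: le_max_iff_disj)
  let ?M = "measurable_mechanisms U V u"
  let ?S = "{v \<in> indirect_utilities. \<forall>\<theta>. u \<theta> \<le> v \<theta>}"
  define I where "I \<kappa> \<phi> = (\<integral>\<^sup>+ \<theta>. ennreal (B - V (\<theta>, \<phi> \<theta>)) \<partial>\<kappa>)" for \<kappa> and \<phi> :: "'t \<Rightarrow> 'c"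
  have integral_eq: "ereal_integral \<kappa> (\<lambda>\<theta>. V (\<theta>, \<phi> \<theta>)) = ereal B - enn2ereal (I \<kappa> \<phi>)"
    if "\<kappa> \<in> \<K>" "\<phi> \<in> ?M" for \<kappa> \<phi>
  proof -
    have "prob_space \<kappa>" "sets \<kappa> = sets borel"
      using assms(7) that(1) unfolding regular_borel_prob_def by auto
    moreover have "(\<lambda>\<theta>. V (\<theta>, \<phi> \<theta>)) \<in> borel_measurable borel"
      using that(2) unfolding measurable_mechanisms_def by simp
    ultimately show ?thesis
      unfolding I_def using B
      by (intro ereal_integral_bounded_above) (auto cong: measurable_cong_sets)
  qed
  have "\<exists>v\<in>?S. \<forall>w\<in>?S. robust_value V \<K> \<alpha> (selection w) \<le> robust_value V \<K> \<alpha> (selection v)"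
  proof (rule compact_attains_max[OF compact_indirect_utilities])
    \<comment> \<open>The constant mechanism offers every type the same contract and is trivially
      incentive compatible.\<close>
    obtain c where "\<forall>\<theta>. U (\<theta>, c) \<ge> u \<theta>"
      using assms(5) by blast
    then have "(\<lambda>_. c) \<in> mechanisms U u"
      unfolding mechanisms_def individually_rational_def incentive_compatible_def by simp
    then show "?S \<noteq> {}"
      using mechanism_in_menu(1,2) by blast
  next
    fix v w
    assume v: "v \<in> ?S"
      and less: "robust_value V \<K> \<alpha> (selection v) < robust_value V \<K> \<alpha> (selection w)"
    let ?J = "\<lambda>\<kappa> v. ereal_integral \<kappa> (\<lambda>\<theta>. V (\<theta>, selection v \<theta>)) + ereal (\<alpha> \<kappa>)"
    \<comment> \<open>One measure pushing the infimum down at \<open>v\<close> is enough, since it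
      bounds the infimum from above at nearby points as well.\<close>
    from less obtain \<kappa> where \<kappa>: "\<kappa> \<in> \<K>" and "?J \<kappa> v < robust_value V \<K> \<alpha> (selection w)"
      unfolding robust_value_def[of _ _ _ "selection v"] INF_less_iff by blast
    from ereal_dense2[OF this(2)] obtain r
      where r: "?J \<kappa> v < ereal r" "ereal r < robust_value V \<K> \<alpha> (selection w)"
      by blast
    \<comment> \<open>The first disjunct is separate because \<open>ennreal\<close> truncates
      negative numbers to 0.\<close>
    have iff: "?J \<kappa> x < ereal r \<longleftrightarrow> B + \<alpha> \<kappa> - r < 0 \<or> ennreal (B + \<alpha> \<kappa> - r) < I \<kappa> (selection x)"
      if "x \<in> ?S" for x
      using that by (simp add: integral_eq[OF \<kappa>] selection_in_measurable_mechanisms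
          ereal_diff_add_less_iff)
    have "\<forall>\<^sub>F x in nhds v. x \<in> ?S \<longrightarrow> ?J \<kappa> x < ereal r"
    proof (cases "B + \<alpha> \<kappa> - r < 0")
      case True
      then show ?thesis
        using iff by auto
    next
      case False
      have "\<forall>\<^sub>F x in nhds v. x \<in> ?S \<longrightarrow> ennreal (B + \<alpha> \<kappa> - r) < I \<kappa> (selection x)"
        unfolding I_def
      proof (rule nn_integral_lower_semicontinuous)
        show "regular_borel_prob \<kappa>"
          using assms(7) \<kappa> by blast
        show "ennreal (B + \<alpha> \<kappa> - r) < (\<integral>\<^sup>+ \<theta>. ennreal (B - V (\<theta>, selection v \<theta>)) \<partial>\<kappa>)"
          using iff[OF v] r(1) False unfolding I_def by simp
        fix \<theta> and a :: ennreal
        assume a: "a < ennreal (B - V (\<theta>, selection v \<theta>))"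
        then obtain x where x: "a = ennreal x" "0 \<le> x"
          by (cases a) auto
        have "V (\<theta>, selection v \<theta>) < B - x"
          using a x by (simp add: ennreal_less_iff)
        then have "\<forall>\<^sub>F z in nhds (v, \<theta>).
          fst z \<in> indirect_utilities \<longrightarrow> V (snd z, selection (fst z) (snd z)) < B - x"
          using v by (intro eventually_value_less) auto
        then show "\<forall>\<^sub>F z in nhds (v, \<theta>).
          fst z \<in> ?S \<longrightarrow> a < ennreal (B - V (snd z, selection (fst z) (snd z)))"
          by eventually_elim (auto simp: x ennreal_less_iff)
      qed
      then show ?thesis
        by eventually_elim (use iff in blast)
    qed
    then show "\<forall>\<^sub>F x in nhds v. x \<in> ?S \<longrightarrow>
      robust_value V \<K> \<alpha> (selection x) < robust_value V \<K> \<alpha> (selection w)"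
    proof (eventually_elim, intro impI)
      case (elim x)
      assume "x \<in> ?S"
      have "robust_value V \<K> \<alpha> (selection x) \<le> ?J \<kappa> x"
        unfolding robust_value_def using \<kappa> by (rule INF_lower)
      also have "\<dots> < ereal r"
        using elim \<open>x \<in> ?S\<close> by blast
      also note r(2)
      finally show "robust_value V \<K> \<alpha> (selection x) < robust_value V \<K> \<alpha> (selection w)" .
    qed
  qed
  then obtain v where v: "v \<in> ?S"
    and max: "\<And>w. w \<in> ?S \<Longrightarrow> robust_value V \<K> \<alpha> (selection w) \<le> robust_value V \<K> \<alpha> (selection v)"
    by blast
  have sel: "selection v \<in> ?M"
    using v selection_in_measurable_mechanisms by blast
  have "robust_value V \<K> \<alpha> \<psi> \<le> robust_value V \<K> \<alpha> (selection v)" if \<psi>: "\<psi> \<in> ?M" for \<psi>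
  proof -
    define w where "w = (\<lambda>\<theta>. U (\<theta>, \<psi> \<theta>))"
    have "\<psi> \<in> mechanisms U u"
      using \<psi> unfolding measurable_mechanisms_def by simp
    then have w: "w \<in> indirect_utilities" "\<forall>\<theta>. u \<theta> \<le> w \<theta>" "\<psi> \<theta> \<in> menu w \<theta>" for \<theta>
      unfolding w_def by (fact mechanism_in_menu)+
    \<comment> \<open>The selection for the indirect utility of \<psi> does at least as well as
      \<psi> type by type, hence under every measure.\<close>
    have "I \<kappa> (selection w) \<le> I \<kappa> \<psi>" for \<kappa>
      unfolding I_def using selection(2)[OF w(1) w(3)]
      by (intro nn_integral_mono ennreal_leI) simp
    then have "robust_value V \<K> \<alpha> \<psi> \<le> robust_value V \<K> \<alpha> (selection w)"
      unfolding robust_value_def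
      using integral_eq \<psi> selection_in_measurable_mechanisms[OF w(1,2)]
      by (auto intro!: INF_mono' INF_superset_mono add_right_mono ereal_minus_mono
          simp: less_eq_ennreal.rep_eq)
    also have "\<dots> \<le> robust_value V \<K> \<alpha> (selection v)"
      using w by (intro max) simp
    finally show ?thesis .
  qed
  then have "robust_value V \<K> \<alpha> (selection v) = (SUP \<psi>\<in>?M. robust_value V \<K> \<alpha> \<psi>)"
    using sel by (intro antisym SUP_upper SUP_least) auto
  then show ?thesis
    using sel by blast
qed

end
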